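(* Let $A^1,\ldots,A^N\in\mathbb C$, $\bar t_{\mathrm{orig}}\in\mathbb C^N$, and let $\mathcal F^{\alpha,a}\in\mathcal R^{\bar t_{\mathrm{orig}}}[[t^*_{\ge1}]]$, $1\le\alpha\le N$, $a\ge0$, be a collection of functions, with graph $\mathcal C=\{(p^*_*,q^*_* )\in\mathcal H\mid p^\alpha_a=\mathcal F^{\alpha,a}\}\subset\mathcal H$. Then the functions $\mathcal F^{\alpha,a}$ satisfy the equations $$\sum_{b\ge0}q^\beta_{b+1}\frac{\partial\mathcal F^{\alpha,a}}{\partial q^\beta_b}=-\mathcal F^{\alpha,a-1}\ (a\in\mathbb Z),\qquad \sum_{b\ge0}q^\beta_b\frac{\partial\mathcal F^{\alpha,a}}{\partial q^\beta_b}=\mathcal F^{\alpha,a}\ (a\in\mathbb Z),$$ $$\frac{\partial^2\mathcal F^{\alpha,0}}{\partial q^\beta_{b+1}\partial q^\gamma_c}=\frac{\partial\mathcal F^{\mu,0}}{\partial q^\beta_b}\frac{\partial^2\mathcal F^{\alpha,0}}{\partial q^\mu_0\partial q^\gamma_c}\ (b,c\ge0),\qquad \frac{\partial\mathcal F^{\alpha,a+1}}{\partial q^\beta_b}+\frac{\partial\mathcal F^{\alpha,a}}{\partial q^\beta_{b+1}}=\frac{\partial\mathcal F^{\alpha,a}}{\partial q^\mu_0}\frac{\partial\mathcal F^{\mu,0}}{\partial q^\beta_b}\ (a,b\ge0)$$ (for all $1\le\alpha,\beta,\gamma\le N$) if and only if the following three conditions hold: 1. $\mathcal C$ is a cone with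 the vertex at the origin; 2. for any point $f\in\mathcal C$ we have $f\in zT_f\mathcal C$, where $T_f\mathcal C\subset\mathcal H$ is the tangent space to $\mathcal C$ at $f$; 3. for any point $f\in\mathcal C$ the tangent space $T_f\mathcal C$ is tangent to $\mathcal C$ along $zT_f\mathcal C$.
   Context: Repeated Greek indices are summed from $1$ to $N$. $\mathcal R^{\bar t_{\mathrm{orig}}}$ is the ring of formal power series in $t^\alpha_0-t^\alpha_{\mathrm{orig}}$, and $t^\alpha_d$, $d\ge1$, are further formal variables. The variables $q$ and $t$ are related by $q^\beta_b=t^\beta_b-A^\beta\delta_{b,1}$. By convention $\mathcal F^{\alpha,a}:=(-1)^{a+1}q^\alpha_{-a-1}$ for $a<0$. $\mathcal H=\mathbb C^N[[z,z^{-1}]]$; with $\phi_1,\ldots,\phi_N$ the standard basis of $\mathbb C^N$, any $f\in\mathcal H$ is uniquely written as $f=\sum_{d\ge0}\frac{(-1)^{d+1}p^\alpha_d\phi_\alpha}{z^{d+1}}+\sum_{d\ge0}q^\alpha_d\phi_\alpha z^d$, and $p^\alpha_d,q^\alpha_d$ are used as coordinates on $\mathcal H$. The $\mathcal F^{\alpha,a}$ are viewed as formal functions on $\mathcal H_+=\mathbb C^N[[z]]$ near the point $\bar t_{\mathrm{orig}}-A^\alpha\phi_\alpha z$, and $\mathcal C$ is a formal germ of a graph over this point. Conditions 1–3 are understood for this formal germ: $\mathcal C$ is a cone with vertex at the origin if the vector field $\sum_{a\ge 0}\big(q^\alpha_a\frac{\partial}{\partial q^\alpha_a}+p^\alpha_a\frac{\partial}{\partial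 p^\alpha_a}\big)$ is tangent to $\mathcal C$; $T_f\mathcal C$ is spanned by the lifts $e_{\alpha,a}=\frac{\partial}{\partial q^\alpha_a}+\sum_{b\ge0}\frac{\partial\mathcal F^{\beta,b}}{\partial q^\alpha_a}\frac{\partial}{\partial p^\beta_b}$ of the coordinate vector fields and is identified with a subspace of $\mathcal H$; condition 3 means that $zT_f\mathcal C\subset T_f\mathcal C$ and that the tangent space to $\mathcal C$ does not vary (to first order) along the directions in $zT_f\mathcal C$, i.e. the derivatives of the coefficients $\frac{\partial\mathcal F^{\beta,b}}{\partial q^\alpha_a}$ along the tangent vectors $ze_{\gamma,c}$ vanish. *)

theory Defs
  imports "HOL-Analysis.Analysis" "HOL-Library.Multiset"
begin

section \<open>Formal power series in arbitrarily many variables\<close>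

text \<open>
  A monomial in variables of type \<open>'v\<close> is a finite multiset \<open>M\<close>, with \<open>count M v\<close> the exponent
  of \<open>v\<close>. A power series is an arbitrary family of coefficients, so infinitely many variables
  and infinitely many monomials may occur in it.
\<close>

typedef ('v, 'a) mfps = "UNIV :: ('v multiset \<Rightarrow> 'a) set"
  morphisms mcoeff Abs_mfps ..

setup_lifting type_definition_mfps

lemma mfps_eqI: "(\<And>M. mcoeff f M = mcoeff g M) \<Longrightarrow> f = g"
  by transfer auto

lemma finite_submsets: "finite {K. K \<subseteq># (M :: 'v multiset)}"
proof (rule finite_subset)
  show "{K. K \<subseteq># M} \<subseteq> mset ` {xs. set xs \<subseteq> set_mset M \<and> length xs \<le> size M}"
  proof
    fix K assume "K \<in> {K. K \<subseteq># M}"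
    then have K: "K \<subseteq># M" by simp
    obtain xs where xs: "mset xs = K" using ex_mset by blast
    have "set xs \<subseteq> set_mset M" "length xs \<le> size M"
      using set_mset_mono[OF K] size_mset_mono[OF K] xs by auto
    with xs show "K \<in> mset ` {xs. set xs \<subseteq> set_mset M \<and> length xs \<le> size M}" by blast
  qed
qed (simp add: finite_lists_length_le)

lemma finite_mset_splits: "finite {(K, L). K + L = (M :: 'v multiset)}"
proof (rule finite_subset)
  show "{(K, L). K + L = M} \<subseteq> {K. K \<subseteq># M} \<times> {L. L \<subseteq># M}"
    by auto
qed (simp add: finite_submsets)

instantiation mfps :: (type, ab_group_add) ab_group_add
begin

lift_definition zero_mfps :: "('a, 'b) mfps" is "\<lambda>_. 0" .
lift_definition plus_mfps :: "('a, 'b) mfps \<Rightarrow> ('a, 'b) mfps \<Rightarrow> ('a, 'b) mfps"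
  is "\<lambda>f g M. f M + g M" .
lift_definition uminus_mfps :: "('a, 'b) mfps \<Rightarrow> ('a, 'b) mfps" is "\<lambda>f M. - f M" .
lift_definition minus_mfps :: "('a, 'b) mfps \<Rightarrow> ('a, 'b) mfps \<Rightarrow> ('a, 'b) mfps"
  is "\<lambda>f g M. f M - g M" .

instance
  by standard (transfer; simp add: algebra_simps fun_eq_iff)+

end

instantiation mfps :: (type, comm_ring_1) comm_ring_1
begin

lift_definition one_mfps :: "('a, 'b) mfps" is "\<lambda>M. if M = {#} then 1 else 0" .
lift_definition times_mfps :: "('a, 'b) mfps \<Rightarrow> ('a, 'b) mfps \<Rightarrow> ('a, 'b) mfps"
  is "\<lambda>f g M. \<Sum>(K, L) | K + L = M. f K * g L" .

instance
proof
  fix a b c :: "('a, 'b) mfps"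
  show "a * b * c = a * (b * c)"
  proof transfer
    fix f g h :: "'a multiset \<Rightarrow> 'b"
    have "(\<Sum>(K, L) | K + L = M. (\<Sum>(P, Q) | P + Q = K. f P * g Q) * h L) =
          (\<Sum>(P, K) | P + K = M. f P * (\<Sum>(Q, L) | Q + L = K. g Q * h L))" for M
    proof -
      have "(\<Sum>(K, L) | K + L = M. (\<Sum>(P, Q) | P + Q = K. f P * g Q) * h L) =
            (\<Sum>x\<in>{(K, L). K + L = M}. \<Sum>y\<in>{(P, Q). P + Q = fst x}.
               f (fst y) * g (snd y) * h (snd x))"
        by (simp add: case_prod_unfold sum_distrib_right)
      also have "\<dots> = (\<Sum>(x, y)\<in>Sigma {(K, L). K + L = M} (\<lambda>x. {(P, Q). P + Q = fst x}).
               f (fst y) * g (snd y) * h (snd x))"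
        by (rule sum.Sigma) (auto intro: finite_mset_splits)
      also have "\<dots> = (\<Sum>(x, y)\<in>Sigma {(P, K). P + K = M} (\<lambda>x. {(Q, L). Q + L = snd x}).
               f (fst x) * g (fst y) * h (snd y))"
        by (rule sum.reindex_bij_witness
              [where i = "\<lambda>((P, K), (Q, L)). ((P + Q, L), (P, Q))"
                 and j = "\<lambda>((K, L), (P, Q)). ((P, Q + L), (Q, L))"])
           (auto simp: add_ac)
      also have "\<dots> = (\<Sum>x\<in>{(P, K). P + K = M}. \<Sum>y\<in>{(Q, L). Q + L = snd x}.
               f (fst x) * g (fst y) * h (snd y))"
        by (rule sum.Sigma [symmetric]) (auto intro: finite_mset_splits)
      also have "\<dots> = (\<Sum>(P, K) | P + K = M. f P * (\<Sum>(Q, L) | Q + L = K. g Q * h L))"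
        by (simp add: case_prod_unfold sum_distrib_left mult.assoc)
      finally show ?thesis .
    qed
    then show "(\<lambda>M. \<Sum>(K, L) | K + L = M. (\<Sum>(P, Q) | P + Q = K. f P * g Q) * h L) =
          (\<lambda>M. \<Sum>(P, K) | P + K = M. f P * (\<Sum>(Q, L) | Q + L = K. g Q * h L))"
      by (rule ext)
  qed
  show "a * b = b * a"
  proof transfer
    fix f g :: "'a multiset \<Rightarrow> 'b"
    have "(\<Sum>(K, L) | K + L = M. f K * g L) = (\<Sum>(K, L) | K + L = M. g K * f L)" for M
      by (rule sum.reindex_bij_witness
            [where i = "\<lambda>(K, L). (L, K)" and j = "\<lambda>(K, L). (L, K)"])
         (auto simp: add_ac mult.commute)
    then show "(\<lambda>M. \<Sum>(K, L) | K + L = M. f K * g L) = (\<lambda>M. \<Sum>(K, L) | K + L = M. g K * f L)"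
      by (rule ext)
  qed
  show "1 * a = a"
  proof transfer
    fix f :: "'a multiset \<Rightarrow> 'b"
    have "(\<Sum>(K, L) | K + L = M. (if K = {#} then 1 else 0) * f L) = f M" for M
    proof -
      have "(\<Sum>(K, L) | K + L = M. (if K = {#} then 1 else 0) * f L) =
            (\<Sum>(K, L)\<in>{({#} :: 'a multiset, M)}. (if K = {#} then 1 else 0) * f L)"
        by (rule sum.mono_neutral_right) (auto intro: finite_mset_splits split: if_splits)
      then show ?thesis by simp
    qed
    then show "(\<lambda>M. \<Sum>(K, L) | K + L = M. (if K = {#} then 1 else 0) * f L) = f"
      by (rule ext)
  qed
  show "(a + b) * c = a * c + b * c"
    by transfer (simp add: fun_eq_iff case_prod_unfold distrib_right sum.distrib)
  show "(0 :: ('a, 'b) mfps) \<noteq> 1"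
    by transfer (auto simp: fun_eq_iff)
qed

end

lift_definition mfps_const :: "'a::zero \<Rightarrow> ('v, 'a) mfps"
  is "\<lambda>c M. if M = {#} then c else 0" .

lift_definition mfps_var :: "'v \<Rightarrow> ('v, 'a::zero_neq_one) mfps"
  is "\<lambda>v M. if M = {#v#} then 1 else 0" .

lift_definition mfps_deriv :: "'v \<Rightarrow> ('v, 'a::semiring_1) mfps \<Rightarrow> ('v, 'a) mfps"
  is "\<lambda>v f M. of_nat (Suc (count M v)) * f (add_mset v M)" .

text \<open>
  Convergence of a possibly infinite family to \<open>s\<close>: every monomial receives contributions from
  only finitely many members of the family.
\<close>

definition formal_sums :: "('i \<Rightarrow> ('v, 'a::comm_monoid_add) mfps) \<Rightarrow> ('v, 'a) mfps \<Rightarrow> bool"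
    (infix "formal'_sums" 50) where
  "f formal_sums s \<longleftrightarrow>
     (\<forall>M. finite {i. mcoeff (f i) M \<noteq> 0} \<and>
          mcoeff s M = (\<Sum>i | mcoeff (f i) M \<noteq> 0. mcoeff (f i) M))"


section \<open>The loop space and the graph\<close>

text \<open>
  The variable \<open>(\<alpha>, 0)\<close> stands for \<open>t\<^sup>\<alpha>\<^sub>0 - t_orig $ \<alpha>\<close> and \<open>(\<alpha>, d)\<close>, with \<open>d \<ge> 1\<close>, for \<open>t\<^sup>\<alpha>\<^sub>d\<close>;
  the indices \<open>1, \<dots>, N\<close> are the elements of the finite type \<open>'n\<close>.
\<close>

type_synonym 'n formal_fun = "('n \<times> nat, complex) mfps"

definition tvar :: "complex ^ 'n \<Rightarrow> 'n \<Rightarrow> nat \<Rightarrow> 'n formal_fun" where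
  "tvar t_orig \<beta> b = mfps_var (\<beta>, b) + (if b = 0 then mfps_const (t_orig $ \<beta>) else 0)"

definition qvar :: "complex ^ 'n \<Rightarrow> complex ^ 'n \<Rightarrow> 'n \<Rightarrow> nat \<Rightarrow> 'n formal_fun" where
  "qvar A t_orig \<beta> b = tvar t_orig \<beta> b - (if b = 1 then mfps_const (A $ \<beta>) else 0)"

text \<open>Since \<open>q\<close>, \<open>t\<close> and the power series variables differ by constants, this is also
  \<open>\<partial>/\<partial>q\<^sup>\<beta>\<^sub>b\<close>.\<close>

abbreviation Dq :: "'n \<Rightarrow> nat \<Rightarrow> 'n formal_fun \<Rightarrow> 'n formal_fun" where
  "Dq \<beta> b \<equiv> mfps_deriv (\<beta>, b)"

text \<open>The family extended to all integers \<open>a\<close>; for \<open>a < 0\<close> the exponents \<open>a + 1\<close> and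
  \<open>- a - 1 \<ge> 0\<close> have the same parity.\<close>

definition Fext ::
  "complex ^ 'n \<Rightarrow> complex ^ 'n \<Rightarrow> ('n \<Rightarrow> nat \<Rightarrow> 'n formal_fun) \<Rightarrow> 'n \<Rightarrow> int \<Rightarrow> 'n formal_fun" where
  "Fext A t_orig F \<alpha> a =
     (if a \<ge> 0 then F \<alpha> (nat a)
      else (- 1) ^ nat (- a - 1) * qvar A t_orig \<alpha> (nat (- a - 1)))"

text \<open>
  Elements of \<open>\<H>\<close> depending formally on the parameters, i.e. \<open>f = \<Sum>\<^sub>k f \<alpha> k \<phi>\<^sub>\<alpha> z\<^sup>k\<close> with
  coefficients in the ring of formal functions. Both points of the graph and vector fields along
  it are of this type: the graph is a formal germ parametrised by its \<open>q\<close>-coordinates, so a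
  statement about an arbitrary point of it is a statement about the generic point below, whose
  coordinates are formal functions.
\<close>

type_synonym 'n loop_vec = "'n \<Rightarrow> int \<Rightarrow> 'n formal_fun"

definition qcoord :: "'n loop_vec \<Rightarrow> 'n \<Rightarrow> nat \<Rightarrow> 'n formal_fun" where
  "qcoord f \<alpha> d = f \<alpha> (int d)"

definition pcoord :: "'n loop_vec \<Rightarrow> 'n \<Rightarrow> nat \<Rightarrow> 'n formal_fun" where
  "pcoord f \<alpha> d = (- 1) ^ (d + 1) * f \<alpha> (- int d - 1)"

definition of_coords ::
  "('n \<Rightarrow> nat \<Rightarrow> 'n formal_fun) \<Rightarrow> ('n \<Rightarrow> nat \<Rightarrow> 'n formal_fun) \<Rightarrow> 'n loop_vec" where
  "of_coords p q \<alpha> k =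
     (if k \<ge> 0 then q \<alpha> (nat k) else (- 1) ^ nat (- k) * p \<alpha> (nat (- k - 1)))"

definition zmult :: "'n loop_vec \<Rightarrow> 'n loop_vec" where
  "zmult f \<alpha> k = f \<alpha> (k - 1)"

definition graph_point ::
  "complex ^ 'n \<Rightarrow> complex ^ 'n \<Rightarrow> ('n \<Rightarrow> nat \<Rightarrow> 'n formal_fun) \<Rightarrow> 'n loop_vec" where
  "graph_point A t_orig F = of_coords F (qvar A t_orig)"

definition lift_vec :: "('n \<Rightarrow> nat \<Rightarrow> 'n formal_fun) \<Rightarrow> 'n \<Rightarrow> nat \<Rightarrow> 'n loop_vec" where
  "lift_vec F \<alpha> a =
     of_coords (\<lambda>\<beta> b. Dq \<alpha> a (F \<beta> b)) (\<lambda>\<beta> b. if (\<beta>, b) = (\<alpha>, a) then 1 else 0)"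

text \<open>
  The span is taken in the completed sense, i.e. it contains all infinite combinations of the
  lifts that converge formally; for instance the Euler field has infinitely many non-zero
  \<open>q\<close>-components.
\<close>

definition tangent_space :: "('n::finite \<Rightarrow> nat \<Rightarrow> 'n formal_fun) \<Rightarrow> 'n loop_vec set" where
  "tangent_space F =
     {v. \<exists>c. \<forall>\<beta> k. (\<lambda>(\<alpha>, a). c \<alpha> a * lift_vec F \<alpha> a \<beta> k) formal_sums v \<beta> k}"

text \<open>The value at \<open>f\<close> of the vector field
  \<open>\<Sum> (q\<^sup>\<alpha>\<^sub>a \<partial>/\<partial>q\<^sup>\<alpha>\<^sub>a + p\<^sup>\<alpha>\<^sub>a \<partial>/\<partial>p\<^sup>\<alpha>\<^sub>a)\<close>.\<close>

definition euler_field :: "'n loop_vec \<Rightarrow> 'n loop_vec" where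
  "euler_field f = of_coords (pcoord f) (qcoord f)"

definition is_cone ::
  "complex ^ 'n \<Rightarrow> complex ^ 'n \<Rightarrow> ('n::finite \<Rightarrow> nat \<Rightarrow> 'n formal_fun) \<Rightarrow> bool" where
  "is_cone A t_orig F \<longleftrightarrow> euler_field (graph_point A t_orig F) \<in> tangent_space F"

text \<open>\<open>deriv_along v g h\<close>: the derivative of the function \<open>g\<close> on the graph, written in the
  coordinates \<open>q\<close>, along the tangent vector field \<open>v\<close> exists and equals \<open>h\<close>.\<close>

definition deriv_along :: "'n loop_vec \<Rightarrow> 'n formal_fun \<Rightarrow> 'n formal_fun \<Rightarrow> bool" where
  "deriv_along v g h \<longleftrightarrow> (\<lambda>(\<mu>, d). qcoord v \<mu> d * Dq \<mu> d g) formal_sums h"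

definition tangent_along_z :: "('n::finite \<Rightarrow> nat \<Rightarrow> 'n formal_fun) \<Rightarrow> bool" where
  "tangent_along_z F \<longleftrightarrow>
     zmult ` tangent_space F \<subseteq> tangent_space F \<and>
     (\<forall>\<gamma> c \<alpha> a \<beta> b. deriv_along (zmult (lift_vec F \<gamma> c)) (Dq \<alpha> a (F \<beta> b)) 0)"

lemma of_coords_pcoord_qcoord: "of_coords (pcoord f) (qcoord f) = f"
proof (intro ext)
  fix \<alpha> k
  show "of_coords (pcoord f) (qcoord f) \<alpha> k = f \<alpha> k"
  proof (cases "k \<ge> 0")
    case False
    then have "nat (- k) = Suc (nat (- k - 1))" by simp
    with False show ?thesis
      by (simp add: of_coords_def pcoord_def mult.assoc [symmetric] power_add [symmetric]
            flip: mult_2)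
  qed (simp add: of_coords_def qcoord_def)
qed

lemma coords_of_coords:
  "pcoord (of_coords p q) = p" "qcoord (of_coords p q) = q"
proof -
  have "nat (1 + int d) = Suc d" for d by simp
  then show "pcoord (of_coords p q) = p"
    by (simp add: fun_eq_iff pcoord_def of_coords_def mult.assoc [symmetric] 
          power_add [symmetric] flip: mult_2)
  show "qcoord (of_coords p q) = q"
    by (simp add: fun_eq_iff qcoord_def of_coords_def)
qed

end

theory Submission
  imports Defs
begin

text \<open>
  Write \<open>x = x(q)\<close> for the generic point of the graph, so that \<open>x \<beta> k\<close> is its coefficient at
  \<open>\<phi>\<^sub>\<beta> z\<^sup>k\<close>. Up to signs the functions \<open>\<F>\<^sup>\<alpha>\<^sup>,\<^sup>a\<close>, with \<open>a\<close> an arbitrary integer, are exactly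
  the coordinates \<open>x \<alpha> (- a - 1)\<close>, and the lift \<open>e\<^sub>\<alpha>\<^sub>,\<^sub>a\<close> is the derivative
  \<open>\<partial>x/\<partial>q\<^sup>\<alpha>\<^sub>a\<close>. The coefficients of a combination of lifts can be read off from its
  \<open>q\<close>-coordinates, so a vector field \<open>v\<close> is tangent if and only if it differentiates each
  coordinate function \<open>x \<beta> k\<close> to its own component \<open>v \<beta> k\<close> (\<open>tangent_space_iff\<close>). This makes
  every condition on the cone a system of differential equations:

  \<^item> \<open>x \<in> T\<close>, the cone condition, is the dilaton-type equation
    \<open>\<Sum> q\<^sup>\<beta>\<^sub>b \<partial>x/\<partial>q\<^sup>\<beta>\<^sub>b = x\<close>;

  \<^item> \<open>z\<^sup>-\<^sup>1 x \<in> T\<close> is the string-type equation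
    \<open>\<Sum> q\<^sup>\<beta>\<^sub>b\<^sub>+\<^sub>1 \<partial>x/\<partial>q\<^sup>\<beta>\<^sub>b = z\<^sup>-\<^sup>1 x\<close>;

  \<^item> the field \<open>z e\<^sub>\<gamma>\<^sub>,\<^sub>c\<close> has only finitely many \<open>q\<close>-components and acts on functions as
    \<open>W\<^sub>\<gamma>\<^sub>,\<^sub>c = \<partial>/\<partial>q\<^sup>\<gamma>\<^sub>c\<^sub>+\<^sub>1 - \<Sum>\<^sub>\<mu> (\<partial>\<F>\<^sup>\<mu>\<^sup>,\<^sup>0/\<partial>q\<^sup>\<gamma>\<^sub>c) \<partial>/\<partial>q\<^sup>\<mu>\<^sub>0\<close>
    (\<open>deriv_along_zmult_lift_vec\<close>); hence \<open>z e\<^sub>\<gamma>\<^sub>,\<^sub>c \<in> T\<close> is the recursion relating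
    \<open>\<F>\<^sup>\<alpha>\<^sup>,\<^sup>a\<^sup>+\<^sup>1\<close> to \<open>\<F>\<^sup>\<alpha>\<^sup>,\<^sup>a\<close>;

  \<^item> that the coefficients \<open>\<partial>\<F>\<^sup>\<beta>\<^sup>,\<^sup>b/\<partial>q\<^sup>\<alpha>\<^sub>a\<close> are constant along \<open>z e\<^sub>\<gamma>\<^sub>,\<^sub>c\<close> is, for \<open>b = 0\<close>, the
    topological recursion relation.

  Two points remain. Invariance of \<open>T\<close> under \<open>z\<close> concerns infinite combinations of the lifts,
  and follows from the recursion by linearity of convergent formal sums
  (\<open>zmult_tangent_space_iff\<close>). Constancy of the coefficients with \<open>b > 0\<close> follows by induction on
  \<open>b\<close>, because \<open>W\<^sub>\<gamma>\<^sub>,\<^sub>c\<close> is a derivation and the recursion writes a first derivative of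
  \<open>\<F>\<^sup>\<beta>\<^sup>,\<^sup>b\<^sup>+\<^sup>1\<close> as a polynomial in first derivatives of \<open>\<F>\<^sup>\<beta>\<^sup>,\<^sup>b\<close> and \<open>\<F>\<^sup>\<mu>\<^sup>,\<^sup>0\<close>
  (\<open>first_derivatives_annihilated\<close>).
\<close>


section \<open>Partial derivatives of power series\<close>

lemma mcoeff_sum: "mcoeff (\<Sum>i\<in>S. f i) M = (\<Sum>i\<in>S. mcoeff (f i) M)"
  by (induction S rule: infinite_finite_induct) (auto simp: zero_mfps.rep_eq plus_mfps.rep_eq)

lemma mfps_deriv_add: "mfps_deriv v (f + g) = mfps_deriv v f + mfps_deriv v g"
  by transfer (simp add: fun_eq_iff algebra_simps)

lemma mfps_deriv_minus:
  fixes f :: "('v, 'a::comm_ring_1) mfps"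
  shows "mfps_deriv v (- f) = - mfps_deriv v f"
  by transfer (simp add: fun_eq_iff algebra_simps)

lemma mfps_deriv_0: "mfps_deriv v 0 = 0"
  by transfer simp

lemma mfps_deriv_diff:
  fixes f :: "('v, 'a::comm_ring_1) mfps"
  shows "mfps_deriv v (f - g) = mfps_deriv v f - mfps_deriv v g"
  by transfer (simp add: fun_eq_iff algebra_simps)

lemma mfps_deriv_const: "mfps_deriv v (mfps_const c) = 0"
  by transfer simp

lemma mfps_deriv_var:
  "mfps_deriv v (mfps_var w :: ('v, 'a::comm_ring_1) mfps) = (if v = w then 1 else 0)"
  by transfer (auto simp: fun_eq_iff)

lemma mfps_deriv_sign:
  fixes f :: "('v, 'a::comm_ring_1) mfps"
  shows "mfps_deriv v ((- 1) ^ n * f) = (- 1) ^ n * mfps_deriv v f"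
  by (induction n) (simp_all add: mult.assoc mfps_deriv_minus)

text \<open>
  In a product of monomials \<open>K + L = M + v\<close> the exponent of \<open>v\<close> is the sum of the two exponents;
  the terms weighted by the exponent in \<open>K\<close> only involve \<open>K\<close> containing \<open>v\<close>, from which one \<open>v\<close>
  can be removed. The following lemma is that half of the product rule.
\<close>

lemma sum_splits_weighted_count:
  fixes f g :: "'v multiset \<Rightarrow> 'a::comm_ring_1"
  shows "(\<Sum>(K, L) | K + L = add_mset v M. of_nat (count K v) * f K * g L) =
         (\<Sum>(K, L) | K + L = M. of_nat (Suc (count K v)) * f (add_mset v K) * g L)"
proof -
  have "(\<Sum>(K, L) | K + L = add_mset v M. of_nat (count K v) * f K * g L) =
        (\<Sum>(K, L) | K + L = add_mset v M \<and> v \<in># K. of_nat (count K v) * f K * g L)"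
    by (rule sum.mono_neutral_right) (auto intro!: finite_mset_splits count_inI)
  also have "\<dots> = (\<Sum>(K, L) | K + L = M. of_nat (Suc (count K v)) * f (add_mset v K) * g L)"
    by (rule sum.reindex_bij_witness
          [where i = "\<lambda>(K, L). (add_mset v K, L)" and j = "\<lambda>(K, L). (K - {#v#}, L)"])
       (auto simp: Suc_diff_1 count_greater_zero_iff)
  finally show ?thesis .
qed

lemma mfps_deriv_mult:
  fixes f g :: "('v, 'a::comm_ring_1) mfps"
  shows "mfps_deriv v (f * g) = mfps_deriv v f * g + f * mfps_deriv v g"
proof (transfer, rule ext)
  fix v :: 'v and f g :: "'v multiset \<Rightarrow> 'a" and M
  have swap: "(\<Sum>(K, L) | K + L = N. h K L) = (\<Sum>(K, L) | K + L = N. h L K)"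
    for h :: "_ \<Rightarrow> _ \<Rightarrow> 'a" and N :: "'v multiset"
    by (rule sum.reindex_bij_witness
          [where i = "\<lambda>(K, L). (L, K)" and j = "\<lambda>(K, L). (L, K)"])
       (auto simp: add_ac)
  have count: "of_nat (Suc (count M v)) * (f K * g L) =
      of_nat (count K v) * f K * g L + of_nat (count L v) * g L * f K"
    if "K + L = add_mset v M" for K L
  proof -
    have "Suc (count M v) = count K v + count L v"
      using arg_cong[OF that, of "\<lambda>X. count X v"] by simp
    then show ?thesis
      by (simp only: of_nat_add) (simp add: algebra_simps)
  qed
  have "of_nat (Suc (count M v)) * (\<Sum>(K, L) | K + L = add_mset v M. f K * g L) =
        (\<Sum>(K, L) | K + L = add_mset v M. of_nat (count K v) * f K * g L
             + of_nat (count L v) * g L * f K)"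
    unfolding sum_distrib_left
    by (rule sum.cong) (auto simp: count simp del: of_nat_Suc)
  also have "\<dots> = (\<Sum>(K, L) | K + L = add_mset v M. of_nat (count K v) * f K * g L)
        + (\<Sum>(K, L) | K + L = add_mset v M. of_nat (count K v) * g K * f L)"
    by (subst (3) swap) (simp add: sum.distrib case_prod_unfold)
  also have "\<dots> = (\<Sum>(K, L) | K + L = M. of_nat (Suc (count K v)) * f (add_mset v K) * g L)
        + (\<Sum>(K, L) | K + L = M. of_nat (Suc (count K v)) * g (add_mset v K) * f L)"
    by (simp only: sum_splits_weighted_count)
  also have "\<dots> = (\<Sum>(K, L) | K + L = M. of_nat (Suc (count K v)) * f (add_mset v K) * g L)
        + (\<Sum>(K, L) | K + L = M. f K * (of_nat (Suc (count L v)) * g (add_mset v L)))"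
    by (subst (2) swap) (simp add: mult.commute)
  finally show "of_nat (Suc (count M v)) * (\<Sum>(K, L) | K + L = add_mset v M. f K * g L) =
        (\<Sum>(K, L) | K + L = M. of_nat (Suc (count K v)) * f (add_mset v K) * g L)
        + (\<Sum>(K, L) | K + L = M. f K * (of_nat (Suc (count L v)) * g (add_mset v L)))" .
qed


section \<open>Convergent formal sums\<close>

lemma formal_sumsI:
  assumes "\<And>M. \<exists>S. finite S \<and> (\<forall>i. i \<notin> S \<longrightarrow> mcoeff (f i) M = 0) \<and>
             mcoeff s M = (\<Sum>i\<in>S. mcoeff (f i) M)"
  shows "f formal_sums s"
  unfolding formal_sums_def
proof (intro allI conjI)
  fix M
  obtain S where S: "finite S" "\<And>i. i \<notin> S \<Longrightarrow> mcoeff (f i) M = 0"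
      "mcoeff s M = (\<Sum>i\<in>S. mcoeff (f i) M)"
    using assms by blast
  have sub: "{i. mcoeff (f i) M \<noteq> 0} \<subseteq> S"
    using S(2) by blast
  then show "finite {i. mcoeff (f i) M \<noteq> 0}"
    using S(1) finite_subset by blast
  show "mcoeff s M = (\<Sum>i | mcoeff (f i) M \<noteq> 0. mcoeff (f i) M)"
    unfolding S(3) by (rule sum.mono_neutral_right) (use S(1) sub in auto)
qed

lemma formal_sums_finite_support:
  assumes "f formal_sums s"
  shows "finite {i. mcoeff (f i) M \<noteq> 0}"
  using assms by (auto simp: formal_sums_def)

lemma formal_sums_mcoeff:
  assumes "f formal_sums s" "finite S" "\<And>i. mcoeff (f i) M \<noteq> 0 \<Longrightarrow> i \<in> S"
  shows "mcoeff s M = (\<Sum>i\<in>S. mcoeff (f i) M)"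
proof -
  have "mcoeff s M = (\<Sum>i | mcoeff (f i) M \<noteq> 0. mcoeff (f i) M)"
    using assms(1) by (auto simp: formal_sums_def)
  also have "\<dots> = (\<Sum>i\<in>S. mcoeff (f i) M)"
    by (rule sum.mono_neutral_left) (use assms in auto)
  finally show ?thesis .
qed

lemma formal_sums_unique:
  assumes "f formal_sums s" "f formal_sums t"
  shows "s = t"
  using assms by (intro mfps_eqI) (simp add: formal_sums_def)

lemma formal_sums_finite:
  assumes "finite S" "\<And>i. i \<notin> S \<Longrightarrow> f i = 0"
  shows "f formal_sums (\<Sum>i\<in>S. f i)"
  using assms by (intro formal_sumsI) (auto simp: mcoeff_sum zero_mfps.rep_eq intro!: exI[of _ S])

lemma formal_sums_single:
  assumes "\<And>i. i \<noteq> j \<Longrightarrow> f i = 0"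
  shows "f formal_sums f j"
  using formal_sums_finite[of "{j}" f] assms by simp

lemma formal_sums_add:
  assumes "f formal_sums s" "g formal_sums t"
  shows "(\<lambda>i. f i + g i) formal_sums (s + t)"
proof (rule formal_sumsI)
  fix M
  define S where "S = {i. mcoeff (f i) M \<noteq> 0} \<union> {i. mcoeff (g i) M \<noteq> 0}"
  have fin: "finite S"
    unfolding S_def using assms by (simp add: formal_sums_finite_support)
  have "mcoeff s M = (\<Sum>i\<in>S. mcoeff (f i) M)" "mcoeff t M = (\<Sum>i\<in>S. mcoeff (g i) M)"
    by (rule formal_sums_mcoeff; (fact | simp add: S_def))+
  then show "\<exists>S. finite S \<and> (\<forall>i. i \<notin> S \<longrightarrow> mcoeff (f i + g i) M = 0) \<and>
        mcoeff (s + t) M = (\<Sum>i\<in>S. mcoeff (f i + g i) M)"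
    using fin by (auto simp: plus_mfps.rep_eq sum.distrib S_def intro!: exI[of _ S])
qed

text \<open>
  A coefficient of \<open>c * f i\<close> at \<open>M\<close> only depends on the coefficients of \<open>f i\<close> at the finitely many
  divisors of \<open>M\<close>, and each of these is non-zero for finitely many \<open>i\<close>.
\<close>

lemma formal_sums_mult_left:
  fixes f :: "'i \<Rightarrow> ('v, 'a::comm_ring_1) mfps"
  assumes "f formal_sums s"
  shows "(\<lambda>i. c * f i) formal_sums (c * s)"
proof (rule formal_sumsI)
  fix M
  define S where "S = (\<Union>L\<in>{L. L \<subseteq># M}. {i. mcoeff (f i) L \<noteq> 0})"
  have fin: "finite S"
    unfolding S_def using assms by (auto intro: finite_submsets formal_sums_finite_support)
  have zero: "mcoeff (f i) L = 0" if "i \<notin> S" "K + L = M" for i K L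
    using that by (auto simp: S_def)
  have coeff: "mcoeff s L = (\<Sum>i\<in>S. mcoeff (f i) L)" if "K + L = M" for K L
    by (rule formal_sums_mcoeff[OF assms fin]) (use zero that in blast)
  have "mcoeff (c * s) M = (\<Sum>(K, L) | K + L = M. \<Sum>i\<in>S. mcoeff c K * mcoeff (f i) L)"
    unfolding times_mfps.rep_eq by (rule sum.cong) (auto simp: coeff sum_distrib_left)
  also have "\<dots> = (\<Sum>i\<in>S. \<Sum>(K, L) | K + L = M. mcoeff c K * mcoeff (f i) L)"
    unfolding case_prod_unfold by (rule sum.swap)
  finally have "mcoeff (c * s) M = (\<Sum>i\<in>S. mcoeff (c * f i) M)"
    by (simp add: times_mfps.rep_eq)
  moreover have "mcoeff (c * f i) M = 0" if "i \<notin> S" for i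
    unfolding times_mfps.rep_eq by (rule sum.neutral) (auto simp: zero[OF that])
  ultimately show "\<exists>S. finite S \<and> (\<forall>i. i \<notin> S \<longrightarrow> mcoeff (c * f i) M = 0) \<and>
        mcoeff (c * s) M = (\<Sum>i\<in>S. mcoeff (c * f i) M)"
    using fin by blast
qed

lemma formal_sums_sum:
  assumes "\<And>j. j \<in> J \<Longrightarrow> f j formal_sums s j"
  shows "(\<lambda>i. \<Sum>j\<in>J. f j i) formal_sums (\<Sum>j\<in>J. s j)"
proof -
  have zero: "(\<lambda>i. 0) formal_sums 0"
    using formal_sums_finite[of "{}" "\<lambda>i. 0"] by simp
  from assms show ?thesis
    by (induction J rule: infinite_finite_induct) (auto simp: zero intro!: formal_sums_add)
qed

lemma formal_sums_diff:
  fixes f g :: "'i \<Rightarrow> ('v, 'a::comm_ring_1) mfps"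
  assumes "f formal_sums s" "g formal_sums t"
  shows "(\<lambda>i. f i - g i) formal_sums (s - t)"
  using formal_sums_add[OF assms(1) formal_sums_mult_left[OF assms(2), of "- 1"]] by simp

lemma formal_sums_reindex_iff:
  assumes "inj h" "\<And>i. i \<notin> range h \<Longrightarrow> f i = 0"
  shows "(\<lambda>j. f (h j)) formal_sums s \<longleftrightarrow> f formal_sums s"
proof -
  have supp: "{i. mcoeff (f i) M \<noteq> 0} = h ` {j. mcoeff (f (h j)) M \<noteq> 0}" for M
    using assms(2) by (fastforce simp: zero_mfps.rep_eq)
  have inj: "inj_on h X" for X
    using assms(1) by (rule inj_on_subset) simp
  show ?thesis
    unfolding formal_sums_def supp
    by (simp add: finite_image_iff[OF inj] sum.reindex[OF inj])
qed

text \<open>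
  Multiplication by \<open>z\<close> shifts the second index by one; the finitely many terms of index \<open>0\<close> can
  be split off without affecting convergence.
\<close>

lemma formal_sums_split_0_iff:
  fixes f :: "'n::finite \<times> nat \<Rightarrow> ('v, 'a::comm_ring_1) mfps"
  shows "f formal_sums s \<longleftrightarrow>
    (\<lambda>(\<mu>, d). f (\<mu>, Suc d)) formal_sums (s - (\<Sum>\<mu>\<in>UNIV. f (\<mu>, 0)))"
proof -
  let ?f0 = "\<lambda>(\<mu>, d). if d = 0 then f (\<mu>, d) else 0"
  let ?f1 = "\<lambda>(\<mu>, d). if d = 0 then 0 else f (\<mu>, d)"
  let ?s0 = "\<Sum>\<mu>\<in>UNIV. f (\<mu>, 0)"
  have inj: "inj (\<lambda>(\<mu> :: 'n, d). (\<mu>, Suc d))"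
    by (auto simp: inj_on_def)
  have zero: "?f1 i = 0" if "i \<notin> range (\<lambda>(\<mu> :: 'n, d). (\<mu>, Suc d))" for i
  proof (cases i)
    case (Pair \<mu> d)
    with that show ?thesis
      by (cases d) (auto simp: image_iff)
  qed
  have f1: "(\<lambda>(\<mu>, d). f (\<mu>, Suc d)) formal_sums t \<longleftrightarrow> ?f1 formal_sums t" for t
    using formal_sums_reindex_iff[of "\<lambda>(\<mu>, d). (\<mu>, Suc d)" ?f1 t, OF inj zero]
    by (simp add: case_prod_unfold)
  have "?f0 formal_sums (\<Sum>i\<in>UNIV \<times> {0}. ?f0 i)"
    by (rule formal_sums_finite) (auto split: if_splits)
  then have f0: "?f0 formal_sums ?s0"
    by (simp flip: sum.cartesian_product)
  have "?f1 formal_sums (s - ?s0)" if "f formal_sums s"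
  proof -
    have "(\<lambda>i. f i - ?f0 i) = ?f1" by auto
    with formal_sums_diff[OF that f0] show ?thesis by simp
  qed
  moreover have "f formal_sums s" if "?f1 formal_sums (s - ?s0)"
  proof -
    have "(\<lambda>i. ?f1 i + ?f0 i) = f" by auto
    with formal_sums_add[OF that f0] show ?thesis by simp
  qed
  ultimately show ?thesis
    unfolding f1 by blast
qed


section \<open>Tangent vectors of the graph\<close>

lemma deriv_along_unique: "deriv_along v g h \<Longrightarrow> deriv_along v g h' \<Longrightarrow> h = h'"
  unfolding deriv_along_def by (rule formal_sums_unique)

lemma deriv_along_mult_left:
  assumes "deriv_along v g h" "\<And>\<mu> d. Dq \<mu> d (c * g) = c * Dq \<mu> d g"
  shows "deriv_along v (c * g) (c * h)"
  using formal_sums_mult_left[OF assms(1)[unfolded deriv_along_def], of c]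
  by (simp add: deriv_along_def assms(2) case_prod_unfold mult.left_commute)

lemma deriv_along_sign_iff:
  "deriv_along v ((- 1) ^ n * g) ((- 1) ^ n * h) \<longleftrightarrow> deriv_along v g h"
proof
  have square: "(- 1) ^ n * ((- 1) ^ n * x) = x" for x :: "'n formal_fun"
    by (simp add: mult.assoc [symmetric] power_add [symmetric] flip: mult_2)
  assume "deriv_along v ((- 1) ^ n * g) ((- 1) ^ n * h)"
  from deriv_along_mult_left[OF this mfps_deriv_sign, of n] show "deriv_along v g h"
    by (simp only: square)
qed (intro deriv_along_mult_left mfps_deriv_sign)

lemma Dq_qvar: "Dq \<alpha> a (qvar A t \<beta> b) = (if (\<beta>, b) = (\<alpha>, a) then 1 else 0)"
  by (auto simp: qvar_def tvar_def mfps_deriv_add mfps_deriv_diff mfps_deriv_const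
        mfps_deriv_var mfps_deriv_0)

lemma graph_point_nonneg: "graph_point A t F \<beta> (int b) = qvar A t \<beta> b"
  by (simp add: graph_point_def of_coords_def)

lemma graph_point_neg:
  "graph_point A t F \<beta> (- int b - 1) = (- 1) ^ Suc b * F \<beta> b"
proof -
  have "nat (1 + int b) = Suc b" by simp
  then show ?thesis by (simp add: graph_point_def of_coords_def)
qed

lemma qcoord_graph_point: "qcoord (graph_point A t F) = qvar A t"
  by (simp add: graph_point_def coords_of_coords)

text \<open>
  Because \<open>q\<^sup>\<beta>\<^sub>b\<close> and \<open>\<F>\<^sup>\<beta>\<^sup>,\<^sup>b\<close> are together the coordinates of the generic point, the lifts need
  no separate treatment of positive and negative powers of \<open>z\<close>.
\<close>

lemma lift_vec_eq_Dq_graph_point: "lift_vec F \<alpha> a \<beta> k = Dq \<alpha> a (graph_point A t F \<beta> k)"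
  by (simp add: lift_vec_def graph_point_def of_coords_def Dq_qvar mfps_deriv_sign)

lemma lift_vec_nonneg: "lift_vec F \<alpha> a \<beta> (int b) = (if (\<beta>, b) = (\<alpha>, a) then 1 else 0)"
  by (simp add: lift_vec_def of_coords_def)

lemma lift_vec_minus_1: "lift_vec F \<alpha> a \<beta> (- 1) = - Dq \<alpha> a (F \<beta> 0)"
  by (simp add: lift_vec_def of_coords_def)

lemma formal_sums_lift_vec_nonneg:
  "(\<lambda>(\<alpha>, a). c \<alpha> a * lift_vec F \<alpha> a \<beta> (int b)) formal_sums c \<beta> b"
proof -
  have "c \<alpha> a * lift_vec F \<alpha> a \<beta> (int b) = 0" if "(\<alpha>, a) \<noteq> (\<beta>, b)" for \<alpha> a
    using that by (auto simp: lift_vec_nonneg)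
  with formal_sums_single[of "(\<beta>, b)" "\<lambda>(\<alpha>, a). c \<alpha> a * lift_vec F \<alpha> a \<beta> (int b)"]
  show ?thesis by (auto simp: lift_vec_nonneg)
qed

text \<open>
  The \<open>q\<close>-components of \<open>\<Sum> c\<^sup>\<alpha>\<^sub>a e\<^sub>\<alpha>\<^sub>,\<^sub>a\<close> are the coefficients \<open>c\<^sup>\<alpha>\<^sub>a\<close> themselves. Hence a
  tangent field determines its coefficients, and its components are the derivatives of the
  coordinate functions along it.
\<close>

lemma tangent_space_iff:
  "v \<in> tangent_space F \<longleftrightarrow> (\<forall>\<beta> k. deriv_along v (graph_point A t F \<beta> k) (v \<beta> k))"
proof
  assume "v \<in> tangent_space F"
  then obtain c where c: "\<And>\<beta> k. (\<lambda>(\<alpha>, a). c \<alpha> a * lift_vec F \<alpha> a \<beta> k) formal_sums v \<beta> k"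
    by (auto simp: tangent_space_def)
  have "qcoord v \<alpha> a = c \<alpha> a" for \<alpha> a
    unfolding qcoord_def using c formal_sums_lift_vec_nonneg by (rule formal_sums_unique)
  with c show "\<forall>\<beta> k. deriv_along v (graph_point A t F \<beta> k) (v \<beta> k)"
    by (simp add: deriv_along_def lift_vec_eq_Dq_graph_point[of F _ _ _ _ A t])
next
  assume "\<forall>\<beta> k. deriv_along v (graph_point A t F \<beta> k) (v \<beta> k)"
  then show "v \<in> tangent_space F"
    unfolding tangent_space_def deriv_along_def
      lift_vec_eq_Dq_graph_point[of F _ _ _ _ A t] by blast
qed

lemma lift_vec_in_tangent_space: "lift_vec F \<alpha> a \<in> tangent_space F"
proof -
  define c :: "'a \<Rightarrow> nat \<Rightarrow> 'a formal_fun"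
    where "c = (\<lambda>\<alpha>' a'. if (\<alpha>', a') = (\<alpha>, a) then 1 else 0)"
  have "(\<lambda>(\<alpha>', a'). c \<alpha>' a' * lift_vec F \<alpha>' a' \<beta> k) formal_sums lift_vec F \<alpha> a \<beta> k" for \<beta> k
    using formal_sums_single[of "(\<alpha>, a)" "\<lambda>(\<alpha>', a'). c \<alpha>' a' * lift_vec F \<alpha>' a' \<beta> k"]
    by (force simp: c_def)
  then show ?thesis
    unfolding tangent_space_def by blast
qed


section \<open>Multiplication of tangent vectors by \<open>z\<close>\<close>

lemma deriv_along_zmult_iff:
  fixes v :: "'n::finite loop_vec"
  shows "deriv_along (zmult v) g h \<longleftrightarrow>
    (\<lambda>(\<alpha>, a). v \<alpha> (int a) * Dq \<alpha> (Suc a) g) formal_sums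
      (h - (\<Sum>\<mu>\<in>UNIV. v \<mu> (- 1) * Dq \<mu> 0 g))"
  unfolding deriv_along_def
  by (subst formal_sums_split_0_iff) (simp add: qcoord_def zmult_def)

text \<open>
  The field \<open>z e\<^sub>\<gamma>\<^sub>,\<^sub>c\<close> has \<open>q\<close>-component \<open>1\<close> in direction \<open>(\<gamma>, c + 1)\<close>, while the coefficient of
  \<open>e\<^sub>\<gamma>\<^sub>,\<^sub>c\<close> at \<open>z\<^sup>-\<^sup>1\<close>, which is \<open>- \<partial>\<F>\<^sup>\<mu>\<^sup>,\<^sup>0/\<partial>q\<^sup>\<gamma>\<^sub>c\<close>, moves to direction \<open>(\<mu>, 0)\<close>.
\<close>

definition zlift_deriv ::
  "('n::finite \<Rightarrow> nat \<Rightarrow> 'n formal_fun) \<Rightarrow> 'n \<Rightarrow> nat \<Rightarrow> 'n formal_fun \<Rightarrow> 'n formal_fun" where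
  "zlift_deriv F \<gamma> c g = Dq \<gamma> (Suc c) g - (\<Sum>\<mu>\<in>UNIV. Dq \<gamma> c (F \<mu> 0) * Dq \<mu> 0 g)"

lemma deriv_along_zmult_lift_vec:
  "deriv_along (zmult (lift_vec F \<gamma> c)) g h \<longleftrightarrow> h = zlift_deriv F \<gamma> c g"
proof -
  have "lift_vec F \<gamma> c \<alpha> (int a) * Dq \<alpha> (Suc a) g = 0" if "(\<alpha>, a) \<noteq> (\<gamma>, c)" for \<alpha> a
    using that by (auto simp: lift_vec_nonneg)
  with formal_sums_single[of "(\<gamma>, c)" "\<lambda>(\<alpha>, a). lift_vec F \<gamma> c \<alpha> (int a) * Dq \<alpha> (Suc a) g"]
  have "(\<lambda>(\<alpha>, a). lift_vec F \<gamma> c \<alpha> (int a) * Dq \<alpha> (Suc a) g) formal_sums Dq \<gamma> (Suc c) g"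
    by (auto simp: lift_vec_nonneg)
  then have "deriv_along (zmult (lift_vec F \<gamma> c)) g (zlift_deriv F \<gamma> c g)"
    by (simp add: deriv_along_zmult_iff zlift_deriv_def lift_vec_minus_1 sum_negf)
  then show ?thesis
    using deriv_along_unique by blast
qed

lemma zlift_deriv_add:
  "zlift_deriv F \<gamma> c (f + g) = zlift_deriv F \<gamma> c f + zlift_deriv F \<gamma> c g"
  by (simp add: zlift_deriv_def mfps_deriv_add algebra_simps sum.distrib)

lemma zlift_deriv_0: "zlift_deriv F \<gamma> c 0 = 0"
  by (simp add: zlift_deriv_def mfps_deriv_0)

lemma zlift_deriv_sum: "zlift_deriv F \<gamma> c (\<Sum>i\<in>S. f i) = (\<Sum>i\<in>S. zlift_deriv F \<gamma> c (f i))"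
  by (induction S rule: infinite_finite_induct) (auto simp: zlift_deriv_0 zlift_deriv_add)

lemma zlift_deriv_mult:
  "zlift_deriv F \<gamma> c (f * g) = zlift_deriv F \<gamma> c f * g + f * zlift_deriv F \<gamma> c g"
  by (simp add: zlift_deriv_def mfps_deriv_mult algebra_simps sum.distrib sum_distrib_left)

lemma zlift_deriv_sign: "zlift_deriv F \<gamma> c ((- 1) ^ n * g) = (- 1) ^ n * zlift_deriv F \<gamma> c g"
  by (simp add: zlift_deriv_def mfps_deriv_sign right_diff_distrib sum_distrib_left
        mult.left_commute)

definition gradient_recursion :: "('n::finite \<Rightarrow> nat \<Rightarrow> 'n formal_fun) \<Rightarrow> bool" where
  "gradient_recursion F \<longleftrightarrow> (\<forall>\<alpha> \<beta> a b.
     Dq \<beta> b (F \<alpha> (Suc a)) + Dq \<beta> (Suc b) (F \<alpha> a) =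
       (\<Sum>\<mu>\<in>UNIV. Dq \<mu> 0 (F \<alpha> a) * Dq \<beta> b (F \<mu> 0)))"

text \<open>
  The right-hand side says that \<open>W\<^sub>\<gamma>\<^sub>,\<^sub>c\<close> differentiates \<open>x\<close> to \<open>z e\<^sub>\<gamma>\<^sub>,\<^sub>c\<close>. For \<open>k \<ge> 0\<close> this
  holds for every \<open>F\<close>: \<open>W\<^sub>\<gamma>\<^sub>,\<^sub>c\<close> was read off from the \<open>q\<close>-components of \<open>z e\<^sub>\<gamma>\<^sub>,\<^sub>c\<close>. For
  \<open>k = - b - 1\<close> it is the recursion for \<open>\<F>\<^sup>\<beta>\<^sup>,\<^sup>b\<close> up to a sign.
\<close>

lemma gradient_recursion_iff_graph_point:
  "gradient_recursion F \<longleftrightarrow> (\<forall>\<gamma> c \<beta> k.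
     zlift_deriv F \<gamma> c (graph_point A t F \<beta> k) = Dq \<gamma> c (graph_point A t F \<beta> (k - 1)))"
  (is "_ \<longleftrightarrow> (\<forall>\<gamma> c \<beta> k. ?eq \<gamma> c \<beta> k)")
proof -
  have nonneg: "?eq \<gamma> c \<beta> (int b)" for \<gamma> c \<beta> b
  proof (cases b)
    case 0
    have "(\<Sum>\<mu>\<in>UNIV. Dq \<gamma> c (F \<mu> 0) * Dq \<mu> 0 (qvar A t \<beta> 0)) = Dq \<gamma> c (F \<beta> 0)"
      by (simp add: Dq_qvar if_distrib sum.delta cong: if_cong)
    with 0 show ?thesis
      using graph_point_neg[of A t F \<beta> 0] graph_point_nonneg[of A t F \<beta> 0]
      by (simp add: zlift_deriv_def Dq_qvar mfps_deriv_minus)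
  next
    case (Suc d)
    then have "int b - 1 = int d" by simp
    with Suc show ?thesis
      by (simp only: graph_point_nonneg zlift_deriv_def Dq_qvar) simp
  qed
  have neg: "?eq \<gamma> c \<beta> (- int b - 1) \<longleftrightarrow>
      Dq \<gamma> c (F \<beta> (Suc b)) + Dq \<gamma> (Suc c) (F \<beta> b) =
        (\<Sum>\<mu>\<in>UNIV. Dq \<mu> 0 (F \<beta> b) * Dq \<gamma> c (F \<mu> 0))" for \<gamma> c \<beta> b
  proof -
    have index: "- int b - 1 - 1 = - int (Suc b) - 1" by simp
    have square: "(- 1) ^ Suc b * ((- 1) ^ Suc b * x) = x" for x :: "'b formal_fun"
      by (simp add: mult.assoc [symmetric] power_add [symmetric] flip: mult_2)
    have "?eq \<gamma> c \<beta> (- int b - 1) \<longleftrightarrow>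
        (- 1) ^ Suc b * zlift_deriv F \<gamma> c (F \<beta> b) = (- 1) ^ Suc b * - Dq \<gamma> c (F \<beta> (Suc b))"
      unfolding index graph_point_neg zlift_deriv_sign mfps_deriv_sign by simp
    also have "\<dots> \<longleftrightarrow> zlift_deriv F \<gamma> c (F \<beta> b) = - Dq \<gamma> c (F \<beta> (Suc b))"
      using square by metis
    also have "\<dots> \<longleftrightarrow> Dq \<gamma> c (F \<beta> (Suc b)) + Dq \<gamma> (Suc c) (F \<beta> b) =
        (\<Sum>\<mu>\<in>UNIV. Dq \<mu> 0 (F \<beta> b) * Dq \<gamma> c (F \<mu> 0))"
      by (auto simp: zlift_deriv_def algebra_simps)
    finally show ?thesis .
  qed
  have split: "(\<forall>k. P k) \<longleftrightarrow> (\<forall>b. P (int b)) \<and> (\<forall>b. P (- int b - 1))" for P :: "int \<Rightarrow> bool"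
    by (metis int_cases minus_add_distrib of_nat_Suc diff_conv_add_uminus add.commute)
  show ?thesis
    unfolding gradient_recursion_def by (subst split) (use nonneg neg in auto)
qed

text \<open>
  Necessity is seen on the lifts. For sufficiency, substitute the recursion in
  \<open>\<Sum> v\<^sup>\<alpha>\<^sub>a \<partial>x/\<partial>q\<^sup>\<alpha>\<^sub>a\<^sub>+\<^sub>1\<close>: one part sums to \<open>z v\<close> because \<open>v\<close> is tangent, and the other cancels
  against the \<open>q\<^sup>\<mu>\<^sub>0\<close>-components of \<open>z v\<close>, again because \<open>v\<close> is tangent.
\<close>

lemma zmult_tangent_space_iff:
  "zmult ` tangent_space F \<subseteq> tangent_space F \<longleftrightarrow> gradient_recursion F"
proof
  \<comment> \<open>\<open>A\<close> and \<open>t\<close> enter the generic point through constants only, so the tangent space does not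
    depend on them and any choice will do.\<close>
  fix A t :: "complex ^ 'a"
  let ?x = "graph_point A t F"
  assume "zmult ` tangent_space F \<subseteq> tangent_space F"
  then have "zmult (lift_vec F \<gamma> c) \<in> tangent_space F" for \<gamma> c
    using lift_vec_in_tangent_space by blast
  then have "zmult (lift_vec F \<gamma> c) \<beta> k = zlift_deriv F \<gamma> c (?x \<beta> k)" for \<gamma> c \<beta> k
    by (simp add: tangent_space_iff[of _ _ A t] deriv_along_zmult_lift_vec)
  then show "gradient_recursion F"
    by (simp add: gradient_recursion_iff_graph_point[of _ A t] zmult_def
          lift_vec_eq_Dq_graph_point[of F _ _ _ _ A t])
next
  fix A t :: "complex ^ 'a"
  let ?x = "graph_point A t F"
  assume "gradient_recursion F"
  then have rec: "zlift_deriv F \<gamma> c (?x \<beta> k) = Dq \<gamma> c (?x \<beta> (k - 1))" for \<gamma> c \<beta> k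
    by (simp add: gradient_recursion_iff_graph_point[of _ A t])
  have Dq_x: "Dq \<gamma> (Suc c) (?x \<beta> k) =
      Dq \<gamma> c (?x \<beta> (k - 1)) - (\<Sum>\<mu>\<in>UNIV. Dq \<gamma> c (?x \<mu> (- 1)) * Dq \<mu> 0 (?x \<beta> k))" for \<gamma> c \<beta> k
    using rec[of \<gamma> c \<beta> k] graph_point_neg[of A t F _ 0]
    by (simp add: zlift_deriv_def mfps_deriv_minus sum_negf algebra_simps)
  show "zmult ` tangent_space F \<subseteq> tangent_space F"
  proof (rule image_subsetI)
    fix v assume "v \<in> tangent_space F"
    then have v: "(\<lambda>(\<alpha>, a). v \<alpha> (int a) * Dq \<alpha> a (?x \<beta> k)) formal_sums v \<beta> k" for \<beta> k
      by (simp add: tangent_space_iff[of _ _ A t] deriv_along_def qcoord_def)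
    have "deriv_along (zmult v) (?x \<beta> k) (v \<beta> (k - 1))" for \<beta> k
    proof -
      have "(\<lambda>i. (\<lambda>(\<alpha>, a). v \<alpha> (int a) * Dq \<alpha> a (?x \<beta> (k - 1))) i -
              (\<Sum>\<mu>\<in>UNIV. Dq \<mu> 0 (?x \<beta> k) * (\<lambda>(\<alpha>, a). v \<alpha> (int a) * Dq \<alpha> a (?x \<mu> (- 1))) i))
            formal_sums (v \<beta> (k - 1) - (\<Sum>\<mu>\<in>UNIV. Dq \<mu> 0 (?x \<beta> k) * v \<mu> (- 1)))"
        by (intro formal_sums_diff formal_sums_sum formal_sums_mult_left v)
      then show ?thesis
        by (simp add: deriv_along_zmult_iff Dq_x case_prod_unfold algebra_simps sum_distrib_left)
    qed
    then show "zmult v \<in> tangent_space F"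
      by (simp add: tangent_space_iff[of _ _ A t] zmult_def)
  qed
qed

text \<open>
  Apply the derivation \<open>W\<^sub>\<gamma>\<^sub>,\<^sub>c\<close> to the recursion: every term other than
  \<open>\<partial>\<F>\<^sup>\<beta>\<^sup>,\<^sup>b\<^sup>+\<^sup>1/\<partial>q\<^sup>\<alpha>\<^sub>a\<close> is killed by the induction hypothesis or by the case \<open>b = 0\<close>.
\<close>

lemma first_derivatives_annihilated:
  assumes "gradient_recursion F"
    and "\<And>\<alpha> a \<beta>. zlift_deriv F \<gamma> c (Dq \<alpha> a (F \<beta> 0)) = 0"
  shows "zlift_deriv F \<gamma> c (Dq \<alpha> a (F \<beta> b)) = 0"
proof (induction b arbitrary: \<alpha> a \<beta>)
  case 0
  show ?case by (rule assms(2))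
next
  case (Suc b)
  have "Dq \<alpha> a (F \<beta> (Suc b)) + Dq \<alpha> (Suc a) (F \<beta> b) =
      (\<Sum>\<mu>\<in>UNIV. Dq \<mu> 0 (F \<beta> b) * Dq \<alpha> a (F \<mu> 0))"
    using assms(1) by (simp add: gradient_recursion_def)
  from arg_cong[OF this, of "zlift_deriv F \<gamma> c"] show ?case
    by (simp add: zlift_deriv_add zlift_deriv_sum zlift_deriv_mult Suc.IH assms(2))
qed

text \<open>
  So the third geometric condition amounts to the recursion together with the topological
  recursion relation, the case of coefficients with \<open>b = 0\<close>.
\<close>

lemma tangent_along_z_iff:
  "tangent_along_z F \<longleftrightarrow>
     gradient_recursion F \<and> (\<forall>\<gamma> c \<alpha> a \<beta>. zlift_deriv F \<gamma> c (Dq \<alpha> a (F \<beta> 0)) = 0)"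
proof -
  have "tangent_along_z F \<longleftrightarrow>
     gradient_recursion F \<and> (\<forall>\<gamma> c \<alpha> a \<beta> b. zlift_deriv F \<gamma> c (Dq \<alpha> a (F \<beta> b)) = 0)"
    by (simp add: tangent_along_z_def zmult_tangent_space_iff deriv_along_zmult_lift_vec
          eq_commute[of 0])
  then show ?thesis
    using first_derivatives_annihilated by blast
qed


section \<open>The Euler field and its shift\<close>

lemma Fext_eq_graph_point:
  "Fext A t F \<alpha> a = (- 1) ^ nat \<bar>a + 1\<bar> * graph_point A t F \<alpha> (- a - 1)"
proof (cases "a \<ge> 0")
  case True
  then have "a = int (nat a)" by simp
  then obtain d where d: "a = int d" by blast
  have "nat \<bar>a + 1\<bar> = Suc d" using d by simp
  then show ?thesis
    by (simp add: Fext_def d graph_point_neg mult.assoc [symmetric] power_add [symmetric]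
          del: power_Suc flip: mult_2)
next
  case False
  then have "nat \<bar>a + 1\<bar> = nat (- a - 1)" "- a - 1 = int (nat (- a - 1))" by auto
  with False show ?thesis
    by (metis Fext_def graph_point_nonneg)
qed

lemma all_int_reflect: "(\<forall>a. P (- a - 1)) \<longleftrightarrow> (\<forall>k::int. P k)"
proof -
  have "- (- k - 1) - 1 = k" for k :: int by simp
  then show ?thesis by metis
qed

lemma is_cone_iff:
  "is_cone A t F \<longleftrightarrow> (\<forall>\<alpha> a. deriv_along (graph_point A t F) (Fext A t F \<alpha> a) (Fext A t F \<alpha> a))"
  by (simp add: is_cone_def euler_field_def of_coords_pcoord_qcoord tangent_space_iff[of _ _ A t]
        Fext_eq_graph_point deriv_along_sign_iff
        all_int_reflect[of "\<lambda>k. deriv_along _ (graph_point A t F _ k) (graph_point A t F _ k)"])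

text \<open>
  The equations for \<open>\<F>\<^sup>\<alpha>\<^sup>,\<^sup>a\<close> and \<open>\<F>\<^sup>\<alpha>\<^sup>,\<^sup>a\<^sup>-\<^sup>1\<close> concern neighbouring coordinates of the generic
  point, which enter with opposite signs; this is the minus sign in the string-type equation.
\<close>

lemma graph_point_in_zmult_tangent_space_iff:
  "graph_point A t F \<in> zmult ` tangent_space F \<longleftrightarrow>
     (\<forall>\<alpha> a. deriv_along (\<lambda>\<beta> k. graph_point A t F \<beta> (k + 1))
              (Fext A t F \<alpha> a) (- Fext A t F \<alpha> (a - 1)))"
proof -
  let ?x = "graph_point A t F"
  let ?w = "\<lambda>\<beta> k. ?x \<beta> (k + 1)"
  have "?x = zmult v \<longleftrightarrow> v = ?w" for v
    by (auto simp: zmult_def fun_eq_iff)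
  then have "?x \<in> zmult ` tangent_space F \<longleftrightarrow> ?w \<in> tangent_space F"
    by (auto simp: image_iff)
  also have "\<dots> \<longleftrightarrow> (\<forall>\<beta> a. deriv_along ?w (?x \<beta> (- a - 1)) (?x \<beta> (- a - 1 + 1)))"
    unfolding tangent_space_iff[of _ _ A t]
    using all_int_reflect[of "\<lambda>k. deriv_along ?w (?x _ k) (?x _ (k + 1))"] by simp
  also have "\<dots> \<longleftrightarrow> (\<forall>\<beta> a. deriv_along ?w (Fext A t F \<beta> a) (- Fext A t F \<beta> (a - 1)))"
  proof -
    have "- Fext A t F \<beta> (a - 1) = (- 1) ^ nat \<bar>a + 1\<bar> * ?x \<beta> (- a - 1 + 1)" for \<beta> a
    proof -
      have "nat \<bar>a + 1\<bar> = Suc (nat \<bar>a\<bar>) \<or> nat \<bar>a\<bar> = Suc (nat \<bar>a + 1\<bar>)" by linarith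
      then have "(- 1) ^ nat \<bar>a + 1\<bar> = - ((- 1) ^ nat \<bar>a\<bar> :: 'a formal_fun)"
        by (elim disjE) (simp_all only: power_Suc, simp_all)
      then show ?thesis
        by (simp only: Fext_eq_graph_point) simp
    qed
    then show ?thesis
      by (simp only: Fext_eq_graph_point[of A t F _ "_ :: int"] deriv_along_sign_iff)
  qed
  finally show ?thesis .
qed


section \<open>Differential equations of the cone\<close>


theorem theorem2p6:
  fixes A t_orig :: "complex ^ 'n"
    and F :: "'n \<Rightarrow> nat \<Rightarrow> ('n \<times> nat, complex) mfps"
  shows
    "((\<forall>\<alpha>. \<forall>a::int.
         (\<lambda>(\<beta>, b). qvar A t_orig \<beta> (b + 1) * Dq \<beta> b (Fext A t_orig F \<alpha> a))
           formal_sums (- Fext A t_orig F \<alpha> (a - 1))) \<and>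
      (\<forall>\<alpha>. \<forall>a::int.
         (\<lambda>(\<beta>, b). qvar A t_orig \<beta> b * Dq \<beta> b (Fext A t_orig F \<alpha> a))
           formal_sums (Fext A t_orig F \<alpha> a)) \<and>
      (\<forall>\<alpha> \<beta> \<gamma> b c.
         Dq \<beta> (b + 1) (Dq \<gamma> c (F \<alpha> 0)) =
           (\<Sum>\<mu>\<in>UNIV. Dq \<beta> b (F \<mu> 0) * Dq \<mu> 0 (Dq \<gamma> c (F \<alpha> 0)))) \<and>
      (\<forall>\<alpha> \<beta> a b.
         Dq \<beta> b (F \<alpha> (a + 1)) + Dq \<beta> (b + 1) (F \<alpha> a) =
           (\<Sum>\<mu>\<in>UNIV. Dq \<mu> 0 (F \<alpha> a) * Dq \<beta> b (F \<mu> 0))))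
     \<longleftrightarrow>
     (is_cone A t_orig F \<and>
      graph_point A t_orig F \<in> zmult ` tangent_space F \<and>
      tangent_along_z F)"
proof -
  let ?x = "graph_point A t_orig F"
  have shift: "qcoord (\<lambda>\<beta> k. ?x \<beta> (k + 1)) \<beta> b = qvar A t_orig \<beta> (b + 1)" for \<beta> b
    using graph_point_nonneg[of A t_orig F \<beta> "b + 1"] by (simp add: qcoord_def add.commute)
  have string: "(\<forall>\<alpha>. \<forall>a::int.
         (\<lambda>(\<beta>, b). qvar A t_orig \<beta> (b + 1) * Dq \<beta> b (Fext A t_orig F \<alpha> a))
           formal_sums (- Fext A t_orig F \<alpha> (a - 1)))
      \<longleftrightarrow> ?x \<in> zmult ` tangent_space F"
    unfolding graph_point_in_zmult_tangent_space_iff deriv_along_def shift ..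
  have dilaton: "(\<forall>\<alpha>. \<forall>a::int.
         (\<lambda>(\<beta>, b). qvar A t_orig \<beta> b * Dq \<beta> b (Fext A t_orig F \<alpha> a))
           formal_sums (Fext A t_orig F \<alpha> a))
      \<longleftrightarrow> is_cone A t_orig F"
    unfolding is_cone_iff deriv_along_def qcoord_graph_point ..
  have trr: "(\<forall>\<alpha> \<beta> \<gamma> b c.
         Dq \<beta> (b + 1) (Dq \<gamma> c (F \<alpha> 0)) =
           (\<Sum>\<mu>\<in>UNIV. Dq \<beta> b (F \<mu> 0) * Dq \<mu> 0 (Dq \<gamma> c (F \<alpha> 0))))
      \<longleftrightarrow> (\<forall>\<beta> b \<gamma> c \<alpha>. zlift_deriv F \<beta> b (Dq \<gamma> c (F \<alpha> 0)) = 0)"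
    unfolding zlift_deriv_def by auto
  have recursion: "(\<forall>\<alpha> \<beta> a b.
         Dq \<beta> b (F \<alpha> (a + 1)) + Dq \<beta> (b + 1) (F \<alpha> a) =
           (\<Sum>\<mu>\<in>UNIV. Dq \<mu> 0 (F \<alpha> a) * Dq \<beta> b (F \<mu> 0)))
      \<longleftrightarrow> gradient_recursion F"
    by (simp add: gradient_recursion_def)
  show ?thesis
    unfolding string dilaton trr recursion tangent_along_z_iff by blast
qed

end
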